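(* (Preservation for the Parameterized Cast Calculus.) Fix any CastStruct. For all typing contexts $\Gamma$, types $A$ and terms $M,M'$ of $CC(\Rightarrow)$: if $M:\Gamma\vdash A$ and $M\longrightarrow M'$, then $M':\Gamma\vdash A$.
   Context: **Types.** Base types $b$: $\mathtt{Nat},\mathtt{Bool},\mathtt{Int},\mathtt{Unit},\bot$. Types: $A,B::=b\mid\,?\mid A\to B\mid A\times B\mid A+B$. Contexts $\Gamma$ are finite sequences of types ($\emptyset$, $\Gamma\cdot A$); variables are de Bruijn indices (index $0$ is the last-added type). Primitive types $P::=b\mid b\to P$; each $b$ denotes a set (naturals, Booleans, integers, one-element set, empty set) and $[\![b\to P]\!]$ is the set of functions $[\![b]\!]\to[\![P]\!]$. Blame labels $\ell$ range over a fixed set. **PreCastStruct**: for all types $A,B$ a set $A\Rightarrow B$ of casts; predicates $\mathsf{Inert}$, $\mathsf{Active}$, $\mathsf{Cross}$ on casts; every cast is active or inert; every inert cast $c:A\Rightarrow(B\otimes C)$ with $\otimes\in\{\to,\times,+\}$ is a cross cast and $A=A_1\otimes A_2$ for some $A_1,A_2$; no cast $c:A\Rightarrow b$ into a base type is inert; and operations taking a cast $c$ and a proof $x$ of $\mathsf{Cross}\,c$: for $c:(A_1\to A_2)\Rightarrow(B_1\to B_2)$, $\mathsf{dom}\,c\,x:B_1\Rightarrow A_1$ and $\mathsf{cod}\,c\,x:A_2\Rightarrow B_2$; for $c:(A_1\times A_2)\Rightarrow(B_1\times B_2)$, $\mathsf{fst}\,c\,x:A_1\Rightarrow B_1$ and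 $\mathsf{snd}\,c\,x:A_2\Rightarrow B_2$; for $c:(A_1+A_2)\Rightarrow(B_1+B_2)$, $\mathsf{inl}\,c\,x:A_1\Rightarrow B_1$ and $\mathsf{inr}\,c\,x:A_2\Rightarrow B_2$. A **CastStruct** is a PreCastStruct together with an operation giving, for each value $V:\Gamma\vdash A$, cast $c:A\Rightarrow B$ and proof $a$ of $\mathsf{Active}\,c$, a term $\mathsf{applyCast}\,V\,c\,a:\Gamma\vdash B$. **Terms** of $CC(\Rightarrow)$ ($M:\Gamma\vdash A$ means $M$ has type $A$ in $\Gamma$): $\$k:\Gamma\vdash P$ for $k\in[\![P]\!]$; $`x:\Gamma\vdash A$ if $x$ has type $A$ in $\Gamma$; $\lambda M:\Gamma\vdash A\to B$ if $M:\Gamma\cdot A\vdash B$; $L\,M:\Gamma\vdash B$ if $L:\Gamma\vdash A\to B$, $M:\Gamma\vdash A$; $\mathtt{if}\,L\,M\,N:\Gamma\vdash B$ if $L:\Gamma\vdash\mathtt{Bool}$ and $M,N:\Gamma\vdash B$; $\mathtt{cons}\,M\,N:\Gamma\vdash A\times B$ if $M:\Gamma\vdash A$, $N:\Gamma\vdash B$; $\pi_iM:\Gamma\vdash A_i$ if $M:\Gamma\vdash A_1\times A_2$; $\mathtt{inl}[B]M:\Gamma\vdash A+B$ if $M:\Gamma\vdash A$; $\mathtt{inr}[A]M:\Gamma\vdash A+B$ if $M:\Gamma\vdash B$; $\mathtt{case}\,L\,M\,N:\Gamma\vdash B$ if $L:\Gamma\vdash A_1+A_2$, $M:\Gamma\vdash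 A_1\to B$, $N:\Gamma\vdash A_2\to B$; $M\langle c\rangle:\Gamma\vdash B$ if $M:\Gamma\vdash A$ and $c:A\Rightarrow B$; $\mathtt{blame}\,\ell:\Gamma\vdash A$ for every $A$. **Values** $V,W$: $\lambda M$; $\$k$; $\mathtt{cons}\,V\,W$; $\mathtt{inl}[B]V$; $\mathtt{inr}[A]V$; $V\langle c\rangle$ with $c$ inert. **Frames** $F$: $\Box\,M$; $V\,\Box$; $\mathtt{if}\,\Box\,M\,N$; $\mathtt{cons}\,V\,\Box$; $\mathtt{cons}\,\Box\,N$; $\pi_i\Box$; $\mathtt{inl}[B]\Box$; $\mathtt{inr}[A]\Box$; $\mathtt{case}\,\Box\,M\,N$; $\Box\langle c\rangle$. $F[M]$ fills the hole. **Reduction** $M\longrightarrow M'$ ($M[V]$ is substitution of $V$ for variable $0$, lowering the other free indices; $\uparrow M$ is weakening by one variable; a frame or $\mathtt{blame}$ is taken at the type required by the position): - $F[M]\longrightarrow F[M']$ if $M\longrightarrow M'$; $F[\mathtt{blame}\,\ell]\longrightarrow\mathtt{blame}\,\ell$. - $V\langle c\rangle\longrightarrow\mathsf{applyCast}\,V\,c\,a$ for $a:\mathsf{Active}\,c$. - For $c$ inert and $x:\mathsf{Cross}\,c$: $V\langle c\rangle\,W\longrightarrow(V\,(W\langle\mathsf{dom}\,c\,x\rangle))\langle\mathsf{cod}\,c\,x\rangle$; $\pi_1(V\langle c\rangle)\longrightarrow(\pi_1V)\langle\mathsf{fst}\,c\,x\rangle$; $\pi_2(V\langle c\rangle)\longrightarrow(\pi_2V)\langle\mathsf{snd}\,c\,x\rangle$;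 $\mathtt{case}\,(V\langle c\rangle)\,M\,N\longrightarrow\mathtt{case}\,V\,(\lambda((\uparrow M)\,(`0\langle\mathsf{inl}\,c\,x\rangle)))\,(\lambda((\uparrow N)\,(`0\langle\mathsf{inr}\,c\,x\rangle)))$. - $(\lambda M)\,V\longrightarrow M[V]$; $\mathtt{if}\,\$\mathtt{true}\,M\,N\longrightarrow M$; $\mathtt{if}\,\$\mathtt{false}\,M\,N\longrightarrow N$; $\pi_1(\mathtt{cons}\,V\,W)\longrightarrow V$; $\pi_2(\mathtt{cons}\,V\,W)\longrightarrow W$; $\mathtt{case}\,(\mathtt{inl}[B]V)\,L\,M\longrightarrow L\,V$; $\mathtt{case}\,(\mathtt{inr}[A]V)\,L\,M\longrightarrow M\,V$; $\$k\,\$k'\longrightarrow\$(k(k'))$. *)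

theory Defs
  imports Main "HOL-Library.FuncSet"
begin

section \<open>Types and primitive constants\<close>

datatype base = BNat | BBool | BInt | BUnit | BBot

datatype ty =
    Base base
  | Dyn
  | Fun ty ty
  | Prod ty ty
  | Sum ty ty

text \<open>The head of the list is the last-added type, i.e. the type of variable 0.\<close>

type_synonym ctx = "ty list"

datatype prim = PBase base | PFun base prim

primrec prim_ty :: "prim \<Rightarrow> ty" where
  "prim_ty (PBase b) = Base b"
| "prim_ty (PFun b P) = Fun (Base b) (prim_ty P)"

datatype base_const = CNat nat | CBool bool | CInt int | CUnit

datatype const = CBase base_const | CFun "base_const \<Rightarrow> const"

primrec base_den :: "base \<Rightarrow> base_const set" where
  "base_den BNat = range CNat"
| "base_den BBool = range CBool"
| "base_den BInt = range CInt"
| "base_den BUnit = {CUnit}"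
| "base_den BBot = {}"

text \<open>
  A function \<open>\<lbrakk>b\<rbrakk> \<rightarrow> \<lbrakk>P\<rbrakk>\<close> is represented by its extensional graph: its value outside
  \<open>\<lbrakk>b\<rbrakk>\<close> is fixed to \<open>undefined\<close>, so that distinct elements are distinct functions.
\<close>

primrec prim_den :: "prim \<Rightarrow> const set" where
  "prim_den (PBase b) = CBase ` base_den b"
| "prim_den (PFun b P) = CFun ` (base_den b \<rightarrow>\<^sub>E prim_den P)"


section \<open>Terms\<close>

text \<open>\<open>'c\<close> is the type of casts and \<open>'l\<close> the type of blame labels.\<close>

datatype ('c, 'l) trm =
    Const const
  | Var nat
  | Lam "('c, 'l) trm"
  | App "('c, 'l) trm" "('c, 'l) trm"
  | If "('c, 'l) trm" "('c, 'l) trm" "('c, 'l) trm"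
  | Pair "('c, 'l) trm" "('c, 'l) trm"
  | Proj1 "('c, 'l) trm"
  | Proj2 "('c, 'l) trm"
  | InL ty "('c, 'l) trm"
  | InR ty "('c, 'l) trm"
  | Case "('c, 'l) trm" "('c, 'l) trm" "('c, 'l) trm"
  | Cast "('c, 'l) trm" 'c
  | Blame 'l

primrec lift :: "nat \<Rightarrow> ('c, 'l) trm \<Rightarrow> ('c, 'l) trm" where
  "lift k (Const a) = Const a"
| "lift k (Var i) = (if i < k then Var i else Var (Suc i))"
| "lift k (Lam M) = Lam (lift (Suc k) M)"
| "lift k (App L M) = App (lift k L) (lift k M)"
| "lift k (If L M N) = If (lift k L) (lift k M) (lift k N)"
| "lift k (Pair M N) = Pair (lift k M) (lift k N)"
| "lift k (Proj1 M) = Proj1 (lift k M)"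
| "lift k (Proj2 M) = Proj2 (lift k M)"
| "lift k (InL B M) = InL B (lift k M)"
| "lift k (InR A M) = InR A (lift k M)"
| "lift k (Case L M N) = Case (lift k L) (lift k M) (lift k N)"
| "lift k (Cast M c) = Cast (lift k M) c"
| "lift k (Blame l) = Blame l"

text \<open>\<open>subst k V M\<close> replaces variable \<open>k\<close> of \<open>M\<close> by \<open>V\<close> and lowers the variables above \<open>k\<close>.\<close>

primrec subst :: "nat \<Rightarrow> ('c, 'l) trm \<Rightarrow> ('c, 'l) trm \<Rightarrow> ('c, 'l) trm" where
  "subst k V (Const a) = Const a"
| "subst k V (Var i) = (if i < k then Var i else if i = k then V else Var (i - 1))"
| "subst k V (Lam M) = Lam (subst (Suc k) (lift 0 V) M)"
| "subst k V (App L M) = App (subst k V L) (subst k V M)"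
| "subst k V (If L M N) = If (subst k V L) (subst k V M) (subst k V N)"
| "subst k V (Pair M N) = Pair (subst k V M) (subst k V N)"
| "subst k V (Proj1 M) = Proj1 (subst k V M)"
| "subst k V (Proj2 M) = Proj2 (subst k V M)"
| "subst k V (InL B M) = InL B (subst k V M)"
| "subst k V (InR A M) = InR A (subst k V M)"
| "subst k V (Case L M N) = Case (subst k V L) (subst k V M) (subst k V N)"
| "subst k V (Cast M c) = Cast (subst k V M) c"
| "subst k V (Blame l) = Blame l"


section \<open>Cast structures\<close>

text \<open>
  \<open>casts S A B\<close> is the set \<open>A \<Rightarrow> B\<close>. Data that depends on the source and target of a
  cast is accommodated by storing these in the elements of \<open>'c\<close>. The operations on cross casts are total functions
  that are constrained only on cast arguments satisfying the relevant predicate.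
\<close>

record 'c pre_cast_struct =
  casts :: "ty \<Rightarrow> ty \<Rightarrow> 'c set"
  inert :: "'c \<Rightarrow> bool"
  active :: "'c \<Rightarrow> bool"
  cross :: "'c \<Rightarrow> bool"
  dom_cast :: "'c \<Rightarrow> 'c"
  cod_cast :: "'c \<Rightarrow> 'c"
  fst_cast :: "'c \<Rightarrow> 'c"
  snd_cast :: "'c \<Rightarrow> 'c"
  inl_cast :: "'c \<Rightarrow> 'c"
  inr_cast :: "'c \<Rightarrow> 'c"

locale pre_cast_struct =
  fixes S :: "('c, 'z) pre_cast_struct_scheme"
  assumes active_or_inert: "c \<in> casts S A B \<Longrightarrow> active S c \<or> inert S c"
    and inert_cross:
      "\<lbrakk>op \<in> {Fun, Prod, Sum}; c \<in> casts S A (op B C); inert S c\<rbrakk>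
        \<Longrightarrow> cross S c \<and> (\<exists>A1 A2. A = op A1 A2)"
    and base_not_inert: "c \<in> casts S A (Base b) \<Longrightarrow> \<not> inert S c"
    and dom_cast: "\<lbrakk>c \<in> casts S (Fun A1 A2) (Fun B1 B2); cross S c\<rbrakk> \<Longrightarrow> dom_cast S c \<in> casts S B1 A1"
    and cod_cast: "\<lbrakk>c \<in> casts S (Fun A1 A2) (Fun B1 B2); cross S c\<rbrakk> \<Longrightarrow> cod_cast S c \<in> casts S A2 B2"
    and fst_cast: "\<lbrakk>c \<in> casts S (Prod A1 A2) (Prod B1 B2); cross S c\<rbrakk> \<Longrightarrow> fst_cast S c \<in> casts S A1 B1"
    and snd_cast: "\<lbrakk>c \<in> casts S (Prod A1 A2) (Prod B1 B2); cross S c\<rbrakk> \<Longrightarrow> snd_cast S c \<in> casts S A2 B2"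
    and inl_cast: "\<lbrakk>c \<in> casts S (Sum A1 A2) (Sum B1 B2); cross S c\<rbrakk> \<Longrightarrow> inl_cast S c \<in> casts S A1 B1"
    and inr_cast: "\<lbrakk>c \<in> casts S (Sum A1 A2) (Sum B1 B2); cross S c\<rbrakk> \<Longrightarrow> inr_cast S c \<in> casts S A2 B2"

inductive has_type ::
  "('c, 'z) pre_cast_struct_scheme \<Rightarrow> ctx \<Rightarrow> ('c, 'l) trm \<Rightarrow> ty \<Rightarrow> bool"
  for S :: "('c, 'z) pre_cast_struct_scheme"
where
  t_const: "k \<in> prim_den P \<Longrightarrow> has_type S \<Gamma> (Const k) (prim_ty P)"
| t_var: "x < length \<Gamma> \<Longrightarrow> has_type S \<Gamma> (Var x) (\<Gamma> ! x)"
| t_lam: "has_type S (A # \<Gamma>) M B \<Longrightarrow> has_type S \<Gamma> (Lam M) (Fun A B)"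
| t_app: "\<lbrakk>has_type S \<Gamma> L (Fun A B); has_type S \<Gamma> M A\<rbrakk> \<Longrightarrow> has_type S \<Gamma> (App L M) B"
| t_if: "\<lbrakk>has_type S \<Gamma> L (Base BBool); has_type S \<Gamma> M B; has_type S \<Gamma> N B\<rbrakk>
    \<Longrightarrow> has_type S \<Gamma> (If L M N) B"
| t_pair: "\<lbrakk>has_type S \<Gamma> M A; has_type S \<Gamma> N B\<rbrakk> \<Longrightarrow> has_type S \<Gamma> (Pair M N) (Prod A B)"
| t_proj1: "has_type S \<Gamma> M (Prod A1 A2) \<Longrightarrow> has_type S \<Gamma> (Proj1 M) A1"
| t_proj2: "has_type S \<Gamma> M (Prod A1 A2) \<Longrightarrow> has_type S \<Gamma> (Proj2 M) A2"
| t_inl: "has_type S \<Gamma> M A \<Longrightarrow> has_type S \<Gamma> (InL B M) (Sum A B)"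
| t_inr: "has_type S \<Gamma> M B \<Longrightarrow> has_type S \<Gamma> (InR A M) (Sum A B)"
| t_case: "\<lbrakk>has_type S \<Gamma> L (Sum A1 A2); has_type S \<Gamma> M (Fun A1 B); has_type S \<Gamma> N (Fun A2 B)\<rbrakk>
    \<Longrightarrow> has_type S \<Gamma> (Case L M N) B"
| t_cast: "\<lbrakk>has_type S \<Gamma> M A; c \<in> casts S A B\<rbrakk> \<Longrightarrow> has_type S \<Gamma> (Cast M c) B"
| t_blame: "has_type S \<Gamma> (Blame l) A"

inductive is_value :: "('c, 'z) pre_cast_struct_scheme \<Rightarrow> ('c, 'l) trm \<Rightarrow> bool"
  for S :: "('c, 'z) pre_cast_struct_scheme"
where
  v_lam: "is_value S (Lam M)"
| v_const: "is_value S (Const k)"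
| v_pair: "\<lbrakk>is_value S V; is_value S W\<rbrakk> \<Longrightarrow> is_value S (Pair V W)"
| v_inl: "is_value S V \<Longrightarrow> is_value S (InL B V)"
| v_inr: "is_value S V \<Longrightarrow> is_value S (InR A V)"
| v_cast: "\<lbrakk>is_value S V; inert S c\<rbrakk> \<Longrightarrow> is_value S (Cast V c)"

text \<open>
  The context of the value is an explicit argument of \<open>apply_cast\<close>, since the operation
  is given separately for the values of each context.
\<close>

record ('c, 'l) cast_struct = "'c pre_cast_struct" +
  apply_cast :: "ctx \<Rightarrow> ('c, 'l) trm \<Rightarrow> 'c \<Rightarrow> ('c, 'l) trm"

locale cast_struct = pre_cast_struct S for S :: "('c, 'l) cast_struct" +
  assumes apply_cast:
    "\<lbrakk>is_value S V; has_type S \<Gamma> V A; c \<in> casts S A B; active S c\<rbrakk>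
      \<Longrightarrow> has_type S \<Gamma> (apply_cast S \<Gamma> V c) B"


section \<open>Reduction\<close>

datatype ('c, 'l) frame =
    FAppL "('c, 'l) trm"
  | FAppR "('c, 'l) trm"
  | FIf "('c, 'l) trm" "('c, 'l) trm"
  | FPairR "('c, 'l) trm"
  | FPairL "('c, 'l) trm"
  | FProj1
  | FProj2
  | FInL ty
  | FInR ty
  | FCase "('c, 'l) trm" "('c, 'l) trm"
  | FCast 'c

primrec plug :: "('c, 'l) frame \<Rightarrow> ('c, 'l) trm \<Rightarrow> ('c, 'l) trm" where
  "plug (FAppL M) L = App L M"
| "plug (FAppR V) M = App V M"
| "plug (FIf M N) L = If L M N"
| "plug (FPairR V) N = Pair V N"
| "plug (FPairL N) M = Pair M N"
| "plug FProj1 M = Proj1 M"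
| "plug FProj2 M = Proj2 M"
| "plug (FInL B) M = InL B M"
| "plug (FInR A) M = InR A M"
| "plug (FCase M N) L = Case L M N"
| "plug (FCast c) M = Cast M c"

text \<open>The terms to the left of the hole must be values.\<close>

fun is_frame :: "('c, 'z) pre_cast_struct_scheme \<Rightarrow> ('c, 'l) frame \<Rightarrow> bool" where
  "is_frame S (FAppR V) \<longleftrightarrow> is_value S V"
| "is_frame S (FPairR V) \<longleftrightarrow> is_value S V"
| "is_frame S _ \<longleftrightarrow> True"

text \<open>
  \<open>step S \<Gamma> M M'\<close> is \<open>M \<longrightarrow> M'\<close> for terms in context \<open>\<Gamma>\<close>; the context is only
  consulted by \<open>apply_cast\<close> and never changes, as reduction does not go under binders.
\<close>

inductive step ::
  "('c, 'l) cast_struct \<Rightarrow> ctx \<Rightarrow> ('c, 'l) trm \<Rightarrow> ('c, 'l) trm \<Rightarrow> bool"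
  for S :: "('c, 'l) cast_struct" and \<Gamma> :: ctx
where
  s_frame: "\<lbrakk>is_frame S F; step S \<Gamma> M M'\<rbrakk> \<Longrightarrow> step S \<Gamma> (plug F M) (plug F M')"
| s_blame: "is_frame S F \<Longrightarrow> step S \<Gamma> (plug F (Blame l)) (Blame l)"
| s_cast: "\<lbrakk>is_value S V; active S c\<rbrakk> \<Longrightarrow> step S \<Gamma> (Cast V c) (apply_cast S \<Gamma> V c)"
| s_fun_cast: "\<lbrakk>is_value S V; is_value S W; inert S c; cross S c\<rbrakk>
    \<Longrightarrow> step S \<Gamma> (App (Cast V c) W) (Cast (App V (Cast W (dom_cast S c))) (cod_cast S c))"
| s_fst_cast: "\<lbrakk>is_value S V; inert S c; cross S c\<rbrakk>
    \<Longrightarrow> step S \<Gamma> (Proj1 (Cast V c)) (Cast (Proj1 V) (fst_cast S c))"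
| s_snd_cast: "\<lbrakk>is_value S V; inert S c; cross S c\<rbrakk>
    \<Longrightarrow> step S \<Gamma> (Proj2 (Cast V c)) (Cast (Proj2 V) (snd_cast S c))"
| s_case_cast: "\<lbrakk>is_value S V; inert S c; cross S c\<rbrakk>
    \<Longrightarrow> step S \<Gamma> (Case (Cast V c) M N)
          (Case V (Lam (App (lift 0 M) (Cast (Var 0) (inl_cast S c))))
                  (Lam (App (lift 0 N) (Cast (Var 0) (inr_cast S c)))))"
| s_beta: "is_value S V \<Longrightarrow> step S \<Gamma> (App (Lam M) V) (subst 0 V M)"
| s_if_true: "step S \<Gamma> (If (Const (CBase (CBool True))) M N) M"
| s_if_false: "step S \<Gamma> (If (Const (CBase (CBool False))) M N) N"
| s_proj1: "\<lbrakk>is_value S V; is_value S W\<rbrakk> \<Longrightarrow> step S \<Gamma> (Proj1 (Pair V W)) V"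
| s_proj2: "\<lbrakk>is_value S V; is_value S W\<rbrakk> \<Longrightarrow> step S \<Gamma> (Proj2 (Pair V W)) W"
| s_case_inl: "is_value S V \<Longrightarrow> step S \<Gamma> (Case (InL B V) L M) (App L V)"
| s_case_inr: "is_value S V \<Longrightarrow> step S \<Gamma> (Case (InR A V) L M) (App M V)"
| s_delta: "step S \<Gamma> (App (Const (CFun f)) (Const (CBase v))) (Const (f v))"

end

theory Submission
  imports Defs
begin

text \<open>Induction on the reduction. The typing rules are syntax-directed, so inverting the
  typing of a redex yields types for its parts, from which the contractum is rebuilt. Beta needs the
  substitution lemma \<open>has_type_subst\<close>, which rests on weakening
  \<open>has_type_lift\<close>; reduction inside a frame needs \<open>has_type_plugE\<close>. For
  the rules that push a cast inward, an inert cast into a function, product or sum type is a cross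
  cast whose source has the same constructor, so its component casts exist at the required types. An
  active cast is covered by the typing condition on \<open>apply_cast\<close>.\<close>

inductive_cases has_type_ConstE: "has_type S \<Gamma> (Const k) T"
inductive_cases has_type_VarE: "has_type S \<Gamma> (Var x) T"
inductive_cases has_type_LamE: "has_type S \<Gamma> (Lam M) T"
inductive_cases has_type_AppE: "has_type S \<Gamma> (App L M) T"
inductive_cases has_type_IfE: "has_type S \<Gamma> (If L M N) T"
inductive_cases has_type_PairE: "has_type S \<Gamma> (Pair M N) T"
inductive_cases has_type_Proj1E: "has_type S \<Gamma> (Proj1 M) T"
inductive_cases has_type_Proj2E: "has_type S \<Gamma> (Proj2 M) T"
inductive_cases has_type_InLE: "has_type S \<Gamma> (InL B M) T"
inductive_cases has_type_InRE: "has_type S \<Gamma> (InR A M) T"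
inductive_cases has_type_CaseE: "has_type S \<Gamma> (Case L M N) T"
inductive_cases has_type_CastE: "has_type S \<Gamma> (Cast M c) T"

lemmas has_type_elims =
  has_type_ConstE has_type_VarE has_type_LamE has_type_AppE has_type_IfE has_type_PairE
  has_type_Proj1E has_type_Proj2E has_type_InLE has_type_InRE has_type_CaseE has_type_CastE

lemma has_type_Var: "x < length \<Gamma> \<Longrightarrow> \<Gamma> ! x = A \<Longrightarrow> has_type S \<Gamma> (Var x) A"
  using t_var by blast

text \<open>The insertion point must vary for the induction to pass under binders: each
  \<open>Lam\<close> adds its argument type to \<Delta>, so the cutoff of \<open>lift\<close> stays
  equal to the length of \<Delta>.\<close>

lemma has_type_lift_append:
  assumes "has_type S (\<Delta> @ \<Gamma>) M A"
  shows "has_type S (\<Delta> @ B # \<Gamma>) (lift (length \<Delta>) M) A"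
  using assms
proof (induction "\<Delta> @ \<Gamma>" M A arbitrary: \<Delta>)
  case (t_var x)
  then show ?case
    by (auto simp: nth_append Suc_diff_le intro!: has_type_Var)
next
  case (t_lam A' M B')
  from t_lam(2)[of "A' # \<Delta>"] show ?case
    by (auto intro: has_type.t_lam)
qed (auto intro: has_type.intros)

lemma has_type_lift: "has_type S \<Gamma> M A \<Longrightarrow> has_type S (B # \<Gamma>) (lift 0 M) A"
  using has_type_lift_append[of S "[]" \<Gamma> M A B] by simp

lemma has_type_subst_append:
  assumes "has_type S (\<Delta> @ B # \<Gamma>) M A" "has_type S (\<Delta> @ \<Gamma>) V B"
  shows "has_type S (\<Delta> @ \<Gamma>) (subst (length \<Delta>) V M) A"
  using assms
proof (induction "\<Delta> @ B # \<Gamma>" M A arbitrary: \<Delta> V)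
  case (t_var x)
  then show ?case
    by (auto simp: nth_append nth_Cons' intro!: has_type_Var)
next
  case (t_lam A' M B')
  \<comment> \<open>Under the binder the substituted term is \<open>lift 0 V\<close>, typed by
    weakening with \<open>A'\<close>; hence the induction generalizes over \<open>V\<close> as well
    as \<Delta>.\<close>
  from t_lam(2)[of "A' # \<Delta>" "lift 0 V"] has_type_lift[OF t_lam(3)] show ?case
    by (auto intro: has_type.t_lam)
qed (auto intro: has_type.intros)

lemma has_type_subst:
  assumes "has_type S (B # \<Gamma>) M A" "has_type S \<Gamma> V B"
  shows "has_type S \<Gamma> (subst 0 V M) A"
  using has_type_subst_append[of S "[]" B \<Gamma> M A V] assms by simp

text \<open>Typing is compositional: a derivation for the whole term uses only the type of the
  subterm in the hole.\<close>

lemma has_type_plugE: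
  assumes "has_type S \<Gamma> (plug F M) A"
  obtains B where "has_type S \<Gamma> M B"
    and "\<And>N. has_type S \<Gamma> N B \<Longrightarrow> has_type S \<Gamma> (plug F N) A"
  using assms by (cases F) (auto elim!: has_type_elims intro: has_type.intros)

text \<open>Constants carry no type annotation, so that \<open>v\<close> lies in the domain of
  \<open>f\<close> must be recovered from the shared type \<open>A\<close>: the function constant
  makes it some \<open>Base b\<close>, and only \<open>PBase b\<close> denotes that type.\<close>

lemma has_type_delta:
  assumes "has_type S \<Gamma> (Const (CFun f)) (Fun A B)" "has_type S \<Gamma> (Const (CBase v)) A"
  shows "has_type S \<Gamma> (Const (f v)) B"
proof -
  obtain P where P: "Fun A B = prim_ty P" "CFun f \<in> prim_den P"
    using assms(1) by (auto elim: has_type_ConstE)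
  then obtain b P' where b: "A = Base b" "B = prim_ty P'" "f \<in> base_den b \<rightarrow>\<^sub>E prim_den P'"
    by (cases P) auto
  obtain Q where "A = prim_ty Q" "CBase v \<in> prim_den Q"
    using assms(2) by (auto elim: has_type_ConstE)
  then have "v \<in> base_den b"
    using b(1) by (cases Q) auto
  then show ?thesis
    using b by (auto intro: t_const)
qed

context pre_cast_struct
begin

text \<open>Inertness supplies both conditions for using the component casts: the cast is cross, and
  its source has the matching shape. The next two lemmas follow the same pattern.\<close>

lemma inert_into_Fun:
  assumes "c \<in> casts S A (Fun B C)" "inert S c"
  obtains A1 A2 where "A = Fun A1 A2" "dom_cast S c \<in> casts S B A1" "cod_cast S c \<in> casts S A2 C"
  using inert_cross[of Fun c A B C] assms dom_cast cod_cast by blast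

lemma inert_into_Prod:
  assumes "c \<in> casts S A (Prod B C)" "inert S c"
  obtains A1 A2 where "A = Prod A1 A2" "fst_cast S c \<in> casts S A1 B" "snd_cast S c \<in> casts S A2 C"
  using inert_cross[of Prod c A B C] assms fst_cast snd_cast by blast

lemma inert_into_Sum:
  assumes "c \<in> casts S A (Sum B C)" "inert S c"
  obtains A1 A2 where "A = Sum A1 A2" "inl_cast S c \<in> casts S A1 B" "inr_cast S c \<in> casts S A2 C"
  using inert_cross[of Sum c A B C] assms inl_cast inr_cast by blast

end

text \<open>Types the new branches when a cast is pushed through \<open>Case\<close>: the bound
  variable has the source component type and is cast before reaching the weakened old
  branch.\<close>

lemma has_type_case_cast_branch:
  assumes "has_type S \<Gamma> M (Fun B C)" "c \<in> casts S A B"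
  shows "has_type S \<Gamma> (Lam (App (lift 0 M) (Cast (Var 0) c))) (Fun A C)"
proof -
  have "has_type S (A # \<Gamma>) (Var 0) A"
    by (rule has_type_Var) auto
  then show ?thesis
    using assms by (blast intro: has_type.intros has_type_lift)
qed

lemma (in cast_struct) preservation:
  assumes "step S \<Gamma> M M'" "has_type S \<Gamma> M A"
  shows "has_type S \<Gamma> M' A"
  using assms
proof (induction arbitrary: A)
  case (s_frame F M M')
  then show ?case by (blast elim: has_type_plugE)
next
  case s_blame
  show ?case by (rule t_blame)
next
  case s_cast
  then show ?case by (blast elim: has_type_CastE intro: apply_cast)
next
  case (s_fun_cast V W c)
  then show ?case
    by (elim has_type_AppE has_type_CastE inert_into_Fun) (auto intro: has_type.intros)
next
  case (s_fst_cast V c)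
  then show ?case
    by (elim has_type_Proj1E has_type_CastE inert_into_Prod) (auto intro: has_type.intros)
next
  case (s_snd_cast V c)
  then show ?case
    by (elim has_type_Proj2E has_type_CastE inert_into_Prod) (auto intro: has_type.intros)
next
  case (s_case_cast V c M N)
  then show ?case
    by (elim has_type_CaseE has_type_CastE inert_into_Sum)
      (auto intro: t_case has_type_case_cast_branch)
next
  case s_beta
  then show ?case by (auto elim!: has_type_AppE has_type_LamE intro: has_type_subst)
next
  case s_delta
  then show ?case by (blast elim: has_type_AppE intro: has_type_delta)
\<comment> \<open>In the remaining rules the result is a subterm of the redex or an application of
  two of them, so inversion suffices.\<close>
qed (auto elim!: has_type_elims intro: has_type.intros)

theorem theorem10:
  fixes S :: "('c, 'l) cast_struct"
    and \<Gamma> :: ctx and A :: ty and M M' :: "('c, 'l) trm"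
  assumes "cast_struct S"
    and "has_type S \<Gamma> M A"
    and "step S \<Gamma> M M'"
  shows "has_type S \<Gamma> M' A"
  using assms by (blast intro: cast_struct.preservation)

end
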